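(* For every integer $k\geq 1$ and every complex $q$ with $|q|<1$, \[ \sum_{n = 1}^\infty \mathrm{FFW}_k (n) q^n=\sum_{j=0}^{k-1}\sum_{m=k}^{\infty}\frac{(-1)^mq^{m(m+1)/2}}{(q;q)_{m}(1-q^{m-j})}. \]
   Context: For a positive integer $n$, $\mathcal{D}(n)$ denotes the set of partitions of $n$ into distinct parts; for $\pi \in \mathcal{D}(n)$, $\#(\pi)$ is the number of parts of $\pi$ and $s_k(\pi)$ is the $k$th smallest part of $\pi$, with $s_k(\pi)=0$ if $\pi$ has fewer than $k$ parts. $\mathrm{FFW}_k(n) := \sum_{\pi \in \mathcal{D}(n)} (-1)^{\#(\pi)} s_k(\pi)$. Here $(a;q)_m=(1-a)(1-aq)\cdots(1-aq^{m-1})$. *)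

theory Defs
  imports "HOL-Analysis.Analysis"
begin

text \<open>Since its parts are distinct, a partition into distinct parts is identified with the
  finite set of its parts.\<close>

definition distinct_partitions :: "nat \<Rightarrow> nat set set" where
  "distinct_partitions n = {P. finite P \<and> (\<forall>x\<in>P. x > 0) \<and> \<Sum>P = n}"

lemma finite_distinct_partitions: "finite (distinct_partitions n)"
proof (rule finite_subset)
  show "distinct_partitions n \<subseteq> Pow {..n}"
    by (auto simp: distinct_partitions_def intro: member_le_sum[where f = "\<lambda>x. x"])
qed simp

text \<open>Parts are numbered from 1; the value for \<open>k = 0\<close> is irrelevant.\<close>

definition kth_smallest_part :: "nat \<Rightarrow> nat set \<Rightarrow> nat" where
  "kth_smallest_part k P = (if card P < k then 0 else sorted_list_of_set P ! (k - 1))"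

definition FFW :: "nat \<Rightarrow> nat \<Rightarrow> int" where
  "FFW k n = (\<Sum>P\<in>distinct_partitions n. (-1) ^ card P * int (kth_smallest_part k P))"

definition qpochhammer :: "'a::comm_ring_1 \<Rightarrow> 'a \<Rightarrow> nat \<Rightarrow> 'a" where
  "qpochhammer a q m = (\<Prod>i<m. 1 - a * q ^ i)"

end

theory Submission
  imports Defs
begin

text \<open>A set of \<open>m + 1\<close> positive integers is uniquely its least element \<open>g\<close> together with the
  translate by \<open>g\<close> of a set of \<open>m\<close> positive integers. Translation contributes \<open>g (m + 1)\<close> to the sum of
  the parts and \<open>g\<close> to the \<open>k\<close>th smallest part, so with \<open>x = q^(m+1)\<close> the generating function of the
  sum is multiplied by \<open>x / (1 - x)\<close>, and the mean of the \<open>k\<close>th smallest part with respect to these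
  weights grows by \<open>1 / (1 - x)\<close>. Induction on \<open>m\<close> thus gives the \<open>m\<close>th term of the theorem
  as the contribution of the partitions into exactly \<open>m\<close> parts. The double sum over \<open>n\<close> and \<open>m\<close> may be
  rearranged since \<open>\<Prod>i. (1 + r^i)\<close> converges for \<open>0 \<le> r < 1\<close>.\<close>

section \<open>Finite sets of positive integers and the shift bijection\<close>

definition positive_finsets :: "nat set set" where
  "positive_finsets = {P. finite P \<and> (\<forall>x\<in>P. x > 0)}"

definition positive_finsets_card :: "nat \<Rightarrow> nat set set" where
  "positive_finsets_card m = {P \<in> positive_finsets. card P = m}"

definition shift_insert :: "nat \<Rightarrow> nat set \<Rightarrow> nat set" where
  "shift_insert g P = insert g ((+) g ` P)"

text \<open>The value 0 at \<open>k = 0\<close> serves as base of the recursion under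
  \<open>shift_insert\<close>: the least part of the new set is \<open>g + 0\<close>. In contrast,
  \<open>kth_smallest_part 0\<close> returns the head of the sorted list.\<close>

definition kth_part :: "nat \<Rightarrow> nat set \<Rightarrow> nat" where
  "kth_part k P = (if k = 0 then 0 else kth_smallest_part k P)"

lemma kth_part_le_sum:
  assumes "finite P"
  shows "kth_part k P \<le> \<Sum>P"
proof (cases "k = 0 \<or> card P < k")
  case False
  then have "sorted_list_of_set P ! (k - 1) \<in> set (sorted_list_of_set P)"
    by (intro nth_mem) auto
  then have "sorted_list_of_set P ! (k - 1) \<in> P"
    using assms by simp
  then show ?thesis
    using False assms member_le_sum[of _ P "\<lambda>x. x"] by (auto simp: kth_part_def kth_smallest_part_def)
qed (auto simp: kth_part_def kth_smallest_part_def)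

text \<open>Translating positive numbers by \<open>g\<close> puts them strictly above
  \<open>g\<close>, so the list stays strictly sorted. Cardinality and \<open>k\<close>th part of
  the new set can then be read off from it.\<close>

lemma sorted_list_of_shift_insert:
  assumes "P \<in> positive_finsets"
  shows "sorted_list_of_set (shift_insert g P) = g # map ((+) g) (sorted_list_of_set P)"
proof -
  have fin: "finite P" and pos: "\<And>x. x \<in> P \<Longrightarrow> x > 0"
    using assms by (auto simp: positive_finsets_def)
  have sw: "sorted_wrt (<) (g # map ((+) g) (sorted_list_of_set P))"
    using pos fin by (auto simp: sorted_wrt_map)
  have "set (g # map ((+) g) (sorted_list_of_set P)) = shift_insert g P"
    using fin by (simp add: shift_insert_def)
  with sw show ?thesis
    by (metis sorted_list_of_set.idem_if_sorted_distinct strict_sorted_iff)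
qed

lemma card_shift_insert:
  assumes "P \<in> positive_finsets"
  shows "card (shift_insert g P) = Suc (card P)"
proof -
  have "card (shift_insert g P) = length (sorted_list_of_set (shift_insert g P))"
    by simp
  also have "\<dots> = Suc (card P)"
    unfolding sorted_list_of_shift_insert[OF assms] by simp
  finally show ?thesis .
qed

lemma sum_shift_insert:
  assumes "P \<in> positive_finsets"
  shows "\<Sum>(shift_insert g P) = g * Suc (card P) + \<Sum>P"
proof -
  have "finite P" "g \<notin> (+) g ` P"
    using assms by (auto simp: positive_finsets_def)
  moreover have "\<Sum>((+) g ` P) = (\<Sum>x\<in>P. g + x)"
    by (subst sum.reindex) (auto simp: inj_on_def)
  ultimately show ?thesis
    by (simp add: shift_insert_def sum.distrib algebra_simps)
qed

lemma kth_part_shift_insert: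
  assumes "P \<in> positive_finsets" "k \<le> card P"
  shows "kth_part (Suc k) (shift_insert g P) = g + kth_part k P"
  using assms card_shift_insert[OF assms(1), of g]
  by (cases k) (auto simp: kth_part_def kth_smallest_part_def sorted_list_of_shift_insert)

lemma bij_betw_shift_insert:
  "bij_betw (\<lambda>(g, P). shift_insert g P) ({1..} \<times> positive_finsets_card m)
     (positive_finsets_card (Suc m))"
  unfolding bij_betw_def
proof
  show "inj_on (\<lambda>(g, P). shift_insert g P) ({1..} \<times> positive_finsets_card m)"
  proof (rule inj_onI, clarify)
    fix g P h Q
    assume "P \<in> positive_finsets_card m" "Q \<in> positive_finsets_card m"
      and eq: "shift_insert g P = shift_insert h Q"
    then have PQ: "P \<in> positive_finsets" "Q \<in> positive_finsets"
      by (auto simp: positive_finsets_card_def)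
    \<comment> \<open>The heads of the two sorted lists give \<open>g = h\<close>; the tails then
      recover the sets.\<close>
    have "g # map ((+) g) (sorted_list_of_set P) = h # map ((+) h) (sorted_list_of_set Q)"
      using eq PQ by (metis sorted_list_of_shift_insert)
    then have gh: "g = h" and "map ((+) g) (sorted_list_of_set P) = map ((+) g) (sorted_list_of_set Q)"
      by auto
    then have "sorted_list_of_set P = sorted_list_of_set Q"
      by (metis add_left_cancel inj_onI map_injective)
    then show "g = h \<and> P = Q"
      using PQ gh by (metis (no_types, lifting) mem_Collect_eq positive_finsets_def
          sorted_list_of_set.set_sorted_key_list_of_set)
  qed
next
  show "(\<lambda>(g, P). shift_insert g P) ` ({1..} \<times> positive_finsets_card m)
      = positive_finsets_card (Suc m)" (is "?L = ?R")
  proof (intro equalityI subsetI)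
    fix Q assume "Q \<in> ?L"
    then obtain g P where gP: "Q = shift_insert g P" "g \<ge> 1" "P \<in> positive_finsets" "card P = m"
      by (auto simp: positive_finsets_card_def)
    then show "Q \<in> ?R"
      using card_shift_insert[of P g]
      by (auto simp: positive_finsets_card_def positive_finsets_def shift_insert_def)
  next
    fix Q assume Q: "Q \<in> ?R"
    define g where "g = Min Q"
    \<comment> \<open>Since \<open>g\<close> is the minimum, the natural subtraction never
      truncates; deleting \<open>g\<close> first keeps 0 out of \<open>P\<close>.\<close>
    define P where "P = (\<lambda>x. x - g) ` (Q - {g})"
    have fin: "finite Q" and ne: "Q \<noteq> {}" and pos: "\<And>x. x \<in> Q \<Longrightarrow> x > 0"
      using Q by (auto simp: positive_finsets_card_def positive_finsets_def)
    have g: "g \<in> Q" and le: "\<And>x. x \<in> Q \<Longrightarrow> g \<le> x"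
      using fin ne by (auto simp: g_def)
    have less: "g < x" if "x \<in> Q - {g}" for x
      using le[of x] that by auto
    have "(+) g ` P = (\<lambda>x. x) ` (Q - {g})"
      unfolding P_def image_image by (intro image_cong) (auto simp: le)
    then have eq: "shift_insert g P = Q"
      using g by (auto simp: shift_insert_def)
    have P: "P \<in> positive_finsets"
      using fin less by (auto simp: P_def positive_finsets_def)
    have "card P = m"
      using card_shift_insert[OF P, of g] Q by (simp add: eq positive_finsets_card_def)
    then have "(g, P) \<in> {1..} \<times> positive_finsets_card m"
      using P pos[OF g] by (simp add: positive_finsets_card_def)
    then show "Q \<in> ?L"
      using eq by (metis (mono_tags, lifting) case_prod_conv image_eqI)
  qed
qed

section \<open>Absolute convergence over all finite sets\<close>

text \<open>Every finite family lies in some \<open>Pow {1..N}\<close>, over which the sum factors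
  as the product of the \<open>1 + r ^ i\<close>. The bound \<open>1 + x \<le> exp x\<close> turns
  this into an estimate independent of \<open>N\<close>.\<close>

lemma summable_on_power_sum_positive_finsets:
  fixes r :: real
  assumes "0 \<le> r" "r < 1"
  shows "(\<lambda>P. r ^ \<Sum>P) summable_on positive_finsets"
proof (rule nonneg_bdd_above_summable_on)
  show "bdd_above (sum (\<lambda>P. r ^ \<Sum>P) ` {F. F \<subseteq> positive_finsets \<and> finite F})"
  proof (rule bdd_aboveI2)
    fix F assume F: "F \<in> {F. F \<subseteq> positive_finsets \<and> finite F}"
    then have "finite (\<Union>F)"
      by (auto simp: positive_finsets_def)
    then obtain N where N: "\<And>x. x \<in> \<Union>F \<Longrightarrow> x \<le> N"
      by (meson finite_nat_set_iff_bounded_le)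
    have sub: "F \<subseteq> Pow {1..N}"
      using F N by (force simp: positive_finsets_def Suc_le_eq)
    have "(\<Sum>P\<in>F. r ^ \<Sum>P) \<le> (\<Sum>P\<in>Pow {1..N}. r ^ \<Sum>P)"
      using assms sub by (intro sum_mono2) auto
    also have "\<dots> = (\<Sum>P\<in>Pow {1..N}. \<Prod>i\<in>P. r ^ i)"
      by (intro sum.cong refl) (simp add: power_sum)
    also have "\<dots> = (\<Prod>i\<in>{1..N}. r ^ i + 1)"
      by (subst prod_add) auto
    also have "\<dots> \<le> (\<Prod>i\<in>{1..N}. exp (r ^ i))"
      using assms by (intro prod_mono) (auto simp: add.commute exp_ge_add_one_self)
    also have "\<dots> = exp (\<Sum>i\<in>{1..N}. r ^ i)"
      by (simp add: exp_sum)
    also have "(\<Sum>i\<in>{1..N}. r ^ i) \<le> (\<Sum>i. r ^ i)"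
      using assms by (intro sum_le_suminf) (auto intro: summable_geometric)
    finally show "(\<Sum>P\<in>F. r ^ \<Sum>P) \<le> exp (\<Sum>i. r ^ i)"
      by simp
  qed
qed (use assms in auto)

text \<open>The powers of \<open>s\<close> decrease, so \<open>n\<close> copies of
  \<open>s ^ n\<close> are dominated by the first \<open>n\<close> terms of the geometric
  series.\<close>

lemma of_nat_mult_power_le:
  fixes s :: real
  assumes "0 \<le> s" "s < 1"
  shows "of_nat n * s ^ n \<le> 1 / (1 - s)"
proof -
  have "of_nat n * s ^ n = (\<Sum>i<n. s ^ n)"
    by simp
  also have "\<dots> \<le> (\<Sum>i<n. s ^ i)"
    using assms by (intro sum_mono power_decreasing) auto
  also have "\<dots> \<le> (\<Sum>i. s ^ i)"
    using assms by (intro sum_le_suminf) (auto intro: summable_geometric)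
  also have "\<dots> = 1 / (1 - s)"
    using assms by (intro suminf_geometric) auto
  finally show ?thesis .
qed

lemma abs_summable_on_kth_part:
  fixes q :: "'a::{real_normed_field,banach}"
  assumes "norm q < 1"
  shows "(\<lambda>P. norm (of_nat (kth_part k P) * q ^ \<Sum>P)) summable_on positive_finsets"
proof (rule Infinite_Sum.abs_summable_on_comparison_test')
  \<comment> \<open>Splitting \<open>norm q\<close> as \<open>s * s\<close> lets one power of
    \<open>s\<close> absorb the linear growth of the \<open>k\<close>th part, while the other
    remains summable.\<close>
  define s where "s = sqrt (norm q)"
  have s: "0 \<le> s" "s < 1" "norm q = s * s"
    using assms by (auto simp: s_def)
  show "(\<lambda>P. 1 / (1 - s) * s ^ \<Sum>P) summable_on positive_finsets"
    using s by (intro summable_on_cmult_right summable_on_power_sum_positive_finsets)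
  fix P assume "P \<in> positive_finsets"
  then have "real (kth_part k P) \<le> real (\<Sum>P)"
    by (subst of_nat_le_iff, intro kth_part_le_sum) (auto simp: positive_finsets_def)
  then have "norm (of_nat (kth_part k P) * q ^ \<Sum>P) \<le> real (\<Sum>P) * norm q ^ \<Sum>P"
    by (simp add: norm_mult norm_power mult_right_mono)
  also have "\<dots> = (real (\<Sum>P) * s ^ \<Sum>P) * s ^ \<Sum>P"
    unfolding s(3) power_mult_distrib by simp
  also have "\<dots> \<le> 1 / (1 - s) * s ^ \<Sum>P"
    using s by (intro mult_right_mono of_nat_mult_power_le) auto
  finally show "norm (of_nat (kth_part k P) * q ^ \<Sum>P) \<le> 1 / (1 - s) * s ^ \<Sum>P" .
qed

lemma abs_summable_on_power_sum_positive_finsets: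
  fixes q :: "'a::{real_normed_field,banach}"
  assumes "norm q < 1"
  shows "(\<lambda>P. norm (q ^ \<Sum>P)) summable_on positive_finsets"
  using summable_on_power_sum_positive_finsets[of "norm q"] assms by (simp add: norm_power)

section \<open>Generating functions for a fixed number of parts\<close>

text \<open>This is \<open>x\<close> times the derivative of the geometric series, reindexed by
  \<open>Suc\<close>.\<close>

lemma has_sum_of_nat_mult_power:
  fixes x :: "'a::{real_normed_field,banach}"
  assumes "norm x < 1"
  shows "((\<lambda>g. of_nat g * x ^ g) has_sum x / (1 - x)\<^sup>2) {1..}"
proof -
  have "summable (\<lambda>n. real (Suc n) * norm x ^ n)"
    using geometric_deriv_sums[of "norm x"] assms by (auto simp: sums_iff)
  then have "((\<lambda>n. of_nat (Suc n) * x ^ n) has_sum 1 / (1 - x)\<^sup>2) UNIV"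
    using assms
    by (intro norm_summable_imp_has_sum geometric_deriv_sums) (simp_all only: norm_mult norm_power norm_of_nat)
  then have "((\<lambda>n. x * (of_nat (Suc n) * x ^ n)) has_sum x * (1 / (1 - x)\<^sup>2)) UNIV"
    by (rule has_sum_cmult_right)
  also have "(\<lambda>n. x * (of_nat (Suc n) * x ^ n)) = (\<lambda>n. of_nat (Suc n) * x ^ Suc n)"
    by (simp add: fun_eq_iff mult_ac)
  finally have "((\<lambda>n. of_nat (Suc n) * x ^ Suc n) has_sum x / (1 - x)\<^sup>2) UNIV"
    by simp
  moreover have "bij_betw Suc UNIV {1..}"
    by (auto simp: bij_betw_def image_iff Suc_le_eq gr0_conv_Suc)
  ultimately show ?thesis
    by (subst (asm) has_sum_reindex_bij_betw)
qed

text \<open>Euler's generating function of the partitions into exactly \<open>m\<close> distinct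
  parts.\<close>

definition q_weight :: "'a::field \<Rightarrow> nat \<Rightarrow> 'a" where
  "q_weight q m = q ^ (m * (m + 1) div 2) / qpochhammer q q m"

lemma q_weight_0 [simp]: "q_weight q 0 = 1"
  by (simp add: q_weight_def qpochhammer_def)

lemma q_weight_Suc: "q_weight q (Suc m) = q ^ Suc m / (1 - q ^ Suc m) * q_weight q m"
proof -
  have "Suc m * (Suc m + 1) div 2 = Suc m + m * (m + 1) div 2"
    by (simp add: algebra_simps)
  then show ?thesis
    by (simp add: q_weight_def qpochhammer_def power_add mult_ac)
qed

text \<open>The common induction step: sum over \<open>P\<close> for fixed \<open>g\<close>, then
  over \<open>g\<close>. Iterated sums alone do not give convergence of the joint sum, so
  summability is a premise; it comes from absolute convergence on
  \<open>positive_finsets\<close>.\<close>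

lemma has_sum_shift_insert:
  fixes f :: "nat set \<Rightarrow> 'a::{topological_comm_monoid_add,t3_space}"
  assumes "f summable_on positive_finsets_card (Suc m)"
    and "\<And>g. g \<ge> 1 \<Longrightarrow> ((\<lambda>P. f (shift_insert g P)) has_sum b g) (positive_finsets_card m)"
    and "(b has_sum S) {1..}"
  shows "(f has_sum S) (positive_finsets_card (Suc m))"
proof -
  let ?h = "\<lambda>(g, P). shift_insert g P"
  have "((\<lambda>z. f (?h z)) has_sum S) ({1..} \<times> positive_finsets_card m)"
  proof (rule has_sum_SigmaI)
    show "(\<lambda>z. f (?h z)) summable_on {1..} \<times> positive_finsets_card m"
      using assms(1) by (subst summable_on_reindex_bij_betw[OF bij_betw_shift_insert])
  qed (use assms in auto)
  then show ?thesis
    by (subst (asm) has_sum_reindex_bij_betw[OF bij_betw_shift_insert])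
qed

lemma positive_finsets_card_0: "positive_finsets_card 0 = {{}}"
  by (auto simp: positive_finsets_card_def positive_finsets_def)

lemma positive_finsets_card_subset: "positive_finsets_card m \<subseteq> positive_finsets"
  by (auto simp: positive_finsets_card_def)

lemma norm_power_Suc_less_1:
  fixes q :: "'a::real_normed_field"
  assumes "norm q < 1"
  shows "norm (q ^ Suc m) < 1"
  using assms power_Suc_less_one[of "norm q" m]
  by (cases "q = 0") (auto simp: norm_power norm_mult power_less_one_iff)

lemma has_sum_power_sum_positive_finsets_card:
  fixes q :: "'a::{real_normed_field,banach}"
  assumes "norm q < 1"
  shows "((\<lambda>P. q ^ \<Sum>P) has_sum q_weight q m) (positive_finsets_card m)"
proof (induction m)
  case 0
  then show ?case
    by (simp add: positive_finsets_card_0 has_sum_finite_iff)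
next
  case (Suc m)
  let ?x = "q ^ Suc m"
  show ?case
  proof (rule has_sum_shift_insert)
    show "(\<lambda>P. q ^ \<Sum>P) summable_on positive_finsets_card (Suc m)"
      using abs_summable_summable[OF abs_summable_on_power_sum_positive_finsets[OF assms]]
        positive_finsets_card_subset by (rule summable_on_subset_banach)
    show "((\<lambda>P. q ^ \<Sum>(shift_insert g P)) has_sum ?x ^ g * q_weight q m) (positive_finsets_card m)" for g
    proof -
      have "((\<lambda>P. ?x ^ g * q ^ \<Sum>P) has_sum ?x ^ g * q_weight q m) (positive_finsets_card m)"
        by (intro has_sum_cmult_right Suc.IH)
      then show ?thesis
        by (rule has_sum_cong[THEN iffD1, rotated])
          (auto simp: positive_finsets_card_def sum_shift_insert power_add power_mult mult.commute
            simp flip: power_Suc power_mult)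
    qed
    have "((\<lambda>g. ?x ^ g) has_sum ?x / (1 - ?x)) {1..}"
      using norm_power_Suc_less_1[OF assms] by (rule has_sum_geometric_from_1)
    then show "((\<lambda>g. ?x ^ g * q_weight q m) has_sum q_weight q (Suc m)) {1..}"
      unfolding q_weight_Suc by (rule has_sum_cmult_left)
  qed
qed

text \<open>The sum over \<open>j\<close> is the mean of the \<open>k\<close>th part under the
  weights \<open>q ^ \<Sum>P\<close>. The induction needs \<open>k\<close> arbitrary, since removing
  the least part lowers both \<open>m\<close> and \<open>k\<close> by one; \<open>k \<le> m\<close>
  keeps all exponents \<open>m - j\<close> positive.\<close>

lemma has_sum_kth_part_positive_finsets_card:
  fixes q :: "'a::{real_normed_field,banach}"
  assumes "norm q < 1" "k \<le> m"
  shows "((\<lambda>P. of_nat (kth_part k P) * q ^ \<Sum>P) has_sum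
            q_weight q m * (\<Sum>j<k. 1 / (1 - q ^ (m - j)))) (positive_finsets_card m)"
  using assms(2)
proof (induction m arbitrary: k)
  case 0
  then show ?case
    by (simp add: kth_part_def)
next
  case (Suc m)
  show ?case
  proof (cases k)
    case 0
    then show ?thesis
      by (simp add: kth_part_def)
  next
    case k: (Suc l)
    let ?x = "q ^ Suc m"
    define A where "A = q_weight q m * (\<Sum>j<l. 1 / (1 - q ^ (m - j)))"
    have x: "norm ?x < 1"
      using assms(1) by (rule norm_power_Suc_less_1)
    then have x1: "1 - ?x \<noteq> 0"
      by (metis eq_iff_diff_eq_0 norm_one order_less_irrefl)
    show ?thesis
    proof (rule has_sum_shift_insert)
      show "(\<lambda>P. of_nat (kth_part k P) * q ^ \<Sum>P) summable_on positive_finsets_card (Suc m)"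
        using abs_summable_summable[OF abs_summable_on_kth_part[OF assms(1)]]
          positive_finsets_card_subset by (rule summable_on_subset_banach)
      \<comment> \<open>The \<open>k\<close>th part is \<open>g\<close> plus the \<open>l\<close>th
        part of \<open>P\<close>; the first summand here comes from \<open>g\<close>, the second
        from the induction hypothesis.\<close>
      show "((\<lambda>P. of_nat (kth_part k (shift_insert g P)) * q ^ \<Sum>(shift_insert g P)) has_sum
          of_nat g * ?x ^ g * q_weight q m + ?x ^ g * A) (positive_finsets_card m)" for g
      proof -
        have "((\<lambda>P. of_nat (kth_part l P) * q ^ \<Sum>P) has_sum A) (positive_finsets_card m)"
          unfolding A_def using Suc.prems k by (intro Suc.IH) simp
        then have "((\<lambda>P. of_nat g * ?x ^ g * q ^ \<Sum>P + ?x ^ g * (of_nat (kth_part l P) * q ^ \<Sum>P)) has_sum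
            of_nat g * ?x ^ g * q_weight q m + ?x ^ g * A) (positive_finsets_card m)"
          by (intro has_sum_add has_sum_cmult_right has_sum_power_sum_positive_finsets_card assms(1))
        moreover have "of_nat g * ?x ^ g * q ^ \<Sum>P + ?x ^ g * (of_nat (kth_part l P) * q ^ \<Sum>P)
            = of_nat (kth_part k (shift_insert g P)) * q ^ \<Sum>(shift_insert g P)"
          if "P \<in> positive_finsets_card m" for P
        proof -
          have P: "P \<in> positive_finsets" "card P = m"
            using that by (auto simp: positive_finsets_card_def)
          have "q ^ \<Sum>(shift_insert g P) = ?x ^ g * q ^ \<Sum>P"
            unfolding sum_shift_insert[OF P(1)] P(2) power_add
            by (simp only: mult.commute[of g] power_mult)
          moreover have "kth_part k (shift_insert g P) = g + kth_part l P"
            unfolding k using P Suc.prems k by (intro kth_part_shift_insert) auto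
          ultimately show ?thesis
            by (simp add: algebra_simps)
        qed
        ultimately show ?thesis
          by (subst has_sum_cong[symmetric]) auto
      qed
      have "((\<lambda>g. of_nat g * ?x ^ g * q_weight q m + ?x ^ g * A) has_sum
          ?x / (1 - ?x)\<^sup>2 * q_weight q m + ?x / (1 - ?x) * A) {1..}"
        by (intro has_sum_add has_sum_cmult_left has_sum_of_nat_mult_power
            has_sum_geometric_from_1 x)
      \<comment> \<open>Both terms contain \<open>?x / (1 - ?x) * q_weight q m\<close>, which is the
        next weight; the squared denominator leaves one extra \<open>1 / (1 - ?x)\<close>.\<close>
      also have "?x / (1 - ?x)\<^sup>2 * q_weight q m + ?x / (1 - ?x) * A
          = q_weight q (Suc m) * (1 / (1 - ?x) + (\<Sum>j<l. 1 / (1 - q ^ (m - j))))"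
        unfolding q_weight_Suc A_def by (simp only: power2_eq_square) (simp add: distrib_left)
      \<comment> \<open>The new summand is the one for \<open>j = 0\<close>; the old ones move up by
        one index because \<open>Suc m - Suc j = m - j\<close>.\<close>
      also have "1 / (1 - ?x) + (\<Sum>j<l. 1 / (1 - q ^ (m - j))) = (\<Sum>j<k. 1 / (1 - q ^ (Suc m - j)))"
        unfolding k by (subst sum.lessThan_Suc_shift) simp
      finally show "((\<lambda>g. of_nat g * ?x ^ g * q_weight q m + ?x ^ g * A) has_sum
          q_weight q (Suc m) * (\<Sum>j<k. 1 / (1 - q ^ (Suc m - j)))) {1..}" .
    qed
  qed
qed

section \<open>Regrouping and summability in the number of parts\<close>

lemma has_sum_finite_sum:
  fixes f :: "'i \<Rightarrow> 'a \<Rightarrow> 'c::topological_comm_monoid_add"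
  assumes "\<And>i. i \<in> I \<Longrightarrow> (f i has_sum s i) A"
  shows "((\<lambda>x. \<Sum>i\<in>I. f i x) has_sum (\<Sum>i\<in>I. s i)) A"
  using assms by (induction I rule: infinite_finite_induct) (auto intro!: has_sum_add)

text \<open>Regrouping by the value of \<open>h\<close> is used both with the sum of the parts and
  with \<open>card\<close>; the disjoint fibres form a Sigma set in bijection with
  \<open>A\<close>.\<close>

lemma has_sum_fibres:
  fixes f :: "'a \<Rightarrow> 'c::{topological_comm_monoid_add,t3_space}"
  assumes "(f has_sum S) A" "h ` A \<subseteq> I"
    and "\<And>i. i \<in> I \<Longrightarrow> (f has_sum b i) {x \<in> A. h x = i}"
  shows "(b has_sum S) I"
proof (rule has_sum_SigmaD)
  have "bij_betw snd (SIGMA i:I. {x \<in> A. h x = i}) A"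
    using assms(2) by (auto simp: bij_betw_def inj_on_def image_iff)
  then show "((\<lambda>z. f (snd z)) has_sum S) (SIGMA i:I. {x \<in> A. h x = i})"
    using assms(1) by (subst has_sum_reindex_bij_betw)
qed (use assms(3) in simp)

text \<open>The weights are the fibre sums under \<open>card\<close> of one convergent sum over all
  finite sets.\<close>

lemma summable_on_q_weight:
  fixes q :: "'a::{real_normed_field,banach}"
  assumes "norm q < 1"
  shows "q_weight q summable_on UNIV"
proof -
  have "(\<lambda>P. q ^ \<Sum>P) summable_on positive_finsets"
    using abs_summable_on_power_sum_positive_finsets[OF assms] by (rule abs_summable_summable)
  then obtain S where "((\<lambda>P. q ^ \<Sum>P) has_sum S) positive_finsets"
    by (auto simp: summable_on_def)
  then have "(q_weight q has_sum S) UNIV"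
  proof (rule has_sum_fibres[where h = card])
    show "((\<lambda>P. q ^ \<Sum>P) has_sum q_weight q m) {P \<in> positive_finsets. card P = m}" for m
      using has_sum_power_sum_positive_finsets_card[OF assms] by (simp add: positive_finsets_card_def)
  qed simp
  then show ?thesis
    by (rule has_sum_imp_summable)
qed

lemma norm_one_minus_power_ge:
  fixes q :: "'a::real_normed_field"
  shows "1 - norm q ^ i \<le> norm (1 - q ^ i)"
  using norm_triangle_ineq2[of 1 "q ^ i"] by (simp add: norm_power)

text \<open>Each factor of the denominator satisfies
  \<open>1 - norm q ^ i \<le> norm (1 - q ^ i)\<close>. The real weights thus form a summable
  majorant.\<close>

lemma norm_q_weight_le:
  fixes q :: "'a::real_normed_field"
  assumes "norm q < 1"
  shows "norm (q_weight q m) \<le> q_weight (norm q) m"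
proof -
  have less: "norm q ^ Suc i < 1" for i
    using norm_power_Suc_less_1[OF assms] by (simp only: norm_power)
  have "qpochhammer (norm q) (norm q) m \<le> norm (qpochhammer q q m)"
    unfolding qpochhammer_def prod_norm[symmetric]
    using less norm_one_minus_power_ge[of q "Suc _"] by (intro prod_mono) (auto intro: less_imp_le)
  moreover have "0 < qpochhammer (norm q) (norm q) m"
    unfolding qpochhammer_def using less by (intro prod_pos) auto
  ultimately show ?thesis
    by (simp add: q_weight_def norm_divide norm_power frac_le)
qed

lemma summable_on_q_weight_divide:
  fixes q :: complex
  assumes "norm q < 1" "j < k"
  shows "(\<lambda>m. (-1) ^ m * q_weight q m / (1 - q ^ (m - j))) summable_on {k..}"
proof (rule abs_summable_summable, rule Infinite_Sum.abs_summable_on_comparison_test')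
  have "q_weight (norm q) summable_on {k..}"
    using summable_on_q_weight[of "norm q"] assms(1) by (auto intro: summable_on_subset_banach)
  then show "(\<lambda>m. q_weight (norm q) m * (1 / (1 - norm q))) summable_on {k..}"
    by (rule summable_on_cmult_left)
  fix m assume "m \<in> {k..}"
  \<comment> \<open>From \<open>j < k \<le> m\<close> the exponent is at least 1, so the extra
    denominator is bounded away from 0 uniformly in \<open>m\<close>.\<close>
  then have "norm q ^ (m - j) \<le> norm q ^ 1"
    using assms by (intro power_decreasing) auto
  then have "1 - norm q \<le> norm (1 - q ^ (m - j))"
    using norm_one_minus_power_ge[of q "m - j"] by simp
  then have "norm (q_weight q m) / norm (1 - q ^ (m - j)) \<le> q_weight (norm q) m / (1 - norm q)"
    using norm_q_weight_le[OF assms(1), of m] assms(1) norm_ge_zero[of "q_weight q m"]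
    by (intro frac_le) linarith+
  then show "norm ((-1) ^ m * q_weight q m / (1 - q ^ (m - j))) \<le> q_weight (norm q) m * (1 / (1 - norm q))"
    by (simp add: norm_mult norm_divide norm_power)
qed

section \<open>Two groupings of one signed sum\<close>

theorem theorem1p4:
  fixes k :: nat and q :: complex
  assumes "k \<ge> 1" and "norm q < 1"
  shows "(\<lambda>n. of_int (FFW k n) * q ^ n) summable_on {1..} \<and>
         (\<forall>j\<in>{0..k-1}. (\<lambda>m. (-1) ^ m * q ^ (m * (m + 1) div 2)
                     / (qpochhammer q q m * (1 - q ^ (m - j)))) summable_on {k..}) \<and>
         (\<Sum>\<^sub>\<infinity>n\<in>{1..}. of_int (FFW k n) * q ^ n) =
         (\<Sum>j=0..k-1. \<Sum>\<^sub>\<infinity>m\<in>{k..}. (-1) ^ m * q ^ (m * (m + 1) div 2)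
                     / (qpochhammer q q m * (1 - q ^ (m - j))))"
proof -
  define t where "t j m = (-1) ^ m * q ^ (m * (m + 1) div 2)
                     / (qpochhammer q q m * (1 - q ^ (m - j)))" for j m
  have t: "t j m = (-1) ^ m * q_weight q m / (1 - q ^ (m - j))" for j m
    by (simp add: t_def q_weight_def)
  have summable_t: "t j summable_on {k..}" if "j < k" for j
    unfolding t using assms(2) that by (rule summable_on_q_weight_divide)
  define f where "f P = (-1) ^ card P * (of_nat (kth_part k P) * q ^ \<Sum>P)" for P
  have f_0: "f P = 0" if "card P < k" for P
    using that by (simp add: f_def kth_part_def kth_smallest_part_def)
  have "(\<lambda>P. norm (f P)) summable_on positive_finsets"
    using abs_summable_on_kth_part[OF assms(2)] by (simp add: f_def norm_mult norm_power)
  then obtain S where S: "(f has_sum S) positive_finsets"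
    using abs_summable_summable by (auto simp: summable_on_def)
  \<comment> \<open>Grouping by the sum of the parts gives the power series. The empty set, the only
    one with sum 0, is dropped; its term vanishes because \<open>k \<ge> 1\<close>.\<close>
  have by_size: "((\<lambda>n. of_int (FFW k n) * q ^ n) has_sum S) {1..}"
  proof (rule has_sum_fibres[where h = Sum])
    show "(f has_sum S) (positive_finsets - {{}})"
      using S assms(1) by (subst has_sum_cong_neutral[where T = positive_finsets and g = f]) (auto intro!: f_0)
    show "\<Sum> ` (positive_finsets - {{}}) \<subseteq> {1..}"
      by (fastforce simp: positive_finsets_def Suc_le_eq intro!: sum_pos)
  next
    fix n :: nat assume "n \<in> {1..}"
    then have eq: "{P \<in> positive_finsets - {{}}. \<Sum>P = n} = distinct_partitions n"
      by (auto simp: positive_finsets_def distinct_partitions_def)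
    have "of_int (FFW k n) * q ^ n = (\<Sum>P\<in>distinct_partitions n. f P)"
      unfolding FFW_def of_int_sum sum_distrib_right using assms(1)
      by (intro sum.cong) (auto simp: f_def kth_part_def distinct_partitions_def)
    then show "(f has_sum of_int (FFW k n) * q ^ n) {P \<in> positive_finsets - {{}}. \<Sum>P = n}"
      unfolding eq by (simp add: has_sum_finite_iff finite_distinct_partitions)
  qed
  \<comment> \<open>Grouping the same total by the number of parts. Sets with fewer than
    \<open>k\<close> parts contribute 0, hence the range \<open>{k..}\<close>.\<close>
  have "((\<lambda>m. \<Sum>j<k. t j m) has_sum S) {k..}"
  proof (rule has_sum_fibres[where h = card])
    show "(f has_sum S) {P \<in> positive_finsets. k \<le> card P}"
      using S by (subst has_sum_cong_neutral[where T = positive_finsets and g = f]) (auto intro!: f_0)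
  next
    fix m assume m: "m \<in> {k..}"
    then have eq: "{P \<in> {P \<in> positive_finsets. k \<le> card P}. card P = m} = positive_finsets_card m"
      by (auto simp: positive_finsets_card_def)
    have "((\<lambda>P. (-1) ^ m * (of_nat (kth_part k P) * q ^ \<Sum>P)) has_sum
        (-1) ^ m * (q_weight q m * (\<Sum>j<k. 1 / (1 - q ^ (m - j))))) (positive_finsets_card m)"
      using m assms(2) by (intro has_sum_cmult_right has_sum_kth_part_positive_finsets_card) auto
    also have "(-1) ^ m * (q_weight q m * (\<Sum>j<k. 1 / (1 - q ^ (m - j)))) = (\<Sum>j<k. t j m)"
      by (simp add: t sum_distrib_left mult.assoc)
    finally show "(f has_sum (\<Sum>j<k. t j m)) {P \<in> {P \<in> positive_finsets. k \<le> card P}. card P = m}"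
      unfolding eq
      by (rule has_sum_cong[THEN iffD1, rotated]) (auto simp: f_def positive_finsets_card_def)
  qed auto
  \<comment> \<open>Each \<open>t j\<close> is summable on its own, so the finite sum over
    \<open>j\<close> may be taken outside.\<close>
  moreover have "((\<lambda>m. \<Sum>j<k. t j m) has_sum (\<Sum>j<k. infsum (t j) {k..})) {k..}"
    by (rule has_sum_finite_sum) (use summable_t in auto)
  ultimately have "S = (\<Sum>j<k. infsum (t j) {k..})"
    by (rule has_sum_unique)
  also have "{..<k} = {0..k-1}"
    using assms(1) by auto
  finally have "S = (\<Sum>j=0..k-1. infsum (t j) {k..})" .
  moreover have "\<forall>j\<in>{0..k-1}. t j summable_on {k..}"
    using summable_t assms(1) by auto
  ultimately show ?thesis
    using by_size unfolding t_def has_sum_iff by simp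
qed

end
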